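(* Let $\lambda_1,\mu_1$ and $\lambda_2,\mu_2$ be the Lamé moduli of two isotropic elastic phases with $\lambda_2+2\mu_2\neq0$, and put $$\sigma_1=\frac{2(\lambda_1+\mu_1)-\lambda_2}{\lambda_2+2\mu_2}.$$ Let $E_\Omega$ be a simply connected inclusion lying strictly within a simply connected body $\Omega\subset\mathbb{R}^2$, and suppose that $E_\Omega$ is an $E_\Omega$-inclusion for conductivity with inclusion conductivity $\sigma_1$ and matrix conductivity $1$, with potentials $V,W$ as described in the context. Define $V'=y$ in $E_\Omega$ and $V'=-W+(1+\sigma_1)y$ in $\Omega\setminus E_\Omega$, and $\mathbf{u}=(V,V')$. Then $$\boldsymbol\varepsilon=\begin{bmatrix}\partial V/\partial x&\partial V'/\partial x\\ \partial V/\partial y&\partial V'/\partial y\end{bmatrix}$$ is symmetric (so it is the strain of the displacement $\mathbf{u}$), equals the identity $\mathbf{I}$ in $E_\Omega$, and solves the elasticity equations $$\boldsymbol\tau=\lambda(x,y)\operatorname{Tr}(\boldsymbol\varepsilon)\mathbf{I}+2\mu(x,y)\boldsymbol\varepsilon,\qquad\nabla\cdot\boldsymbol\tau=0\quad\text{in }\Omega,$$ where $(\lambda,\mu)=(\lambda_1,\mu_1)$ in $E_\Omega$ and $(\lambda,\mu)=(\lambda_2,\mu_2)$ in $\Omega\setminus E_\Omega$. Thus $E_\Omega$ is also an inclusion for elasticity in which, for appropriate boundary conditions on $\partial\Omega$, the strain and stress fields are uniform and hydrostatic.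
   Context: $E_\Omega$-inclusion for conductivity with potentials $V,W$: there are real functions $V,W$ on $\Omega$, continuous across $\partial E_\Omega$ (and with square-integrable gradients), such that $V=x$ and $W=\sigma_1y$ in $E_\Omega$ and $V+iW$ is an analytic function of $x+iy$ in $\Omega\setminus\overline{E_\Omega}$. Here $V$ is the potential solving $\nabla\cdot(\sigma\nabla V)=0$ in $\Omega$ with $\sigma=\sigma_1$ in $E_\Omega$ and $\sigma=1$ outside, having uniform gradient in $E_\Omega$, and $W$ is its conjugate potential. The equation $\nabla\cdot\boldsymbol\tau=0$ in $\Omega$ is in the weak sense, i.e. $\boldsymbol\tau$ is divergence free in each phase with the traction $\boldsymbol\tau\mathbf{n}$ continuous across $\partial E_\Omega$, and $\mathbf{u}$ is continuous across $\partial E_\Omega$. *)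

theory Defs
  imports "HOL-Analysis.Analysis"
begin

text \<open>
  The plane is identified with the complex numbers, the point \<open>(x, y)\<close> being \<open>x + i y\<close>.
  The inclusion \<open>E\<close> is open, so inside \<open>\<Omega>\<close> the two phases (as open sets) are \<open>E\<close> and
  \<open>\<Omega> - closure E\<close>; their union is \<open>\<Omega> - frontier E\<close>.
\<close>

definition dx :: "(complex \<Rightarrow> real) \<Rightarrow> complex \<Rightarrow> real" where
  "dx f z = frechet_derivative f (at z) 1"

definition dy :: "(complex \<Rightarrow> real) \<Rightarrow> complex \<Rightarrow> real" where
  "dy f z = frechet_derivative f (at z) \<i>"

definition grad :: "(complex \<Rightarrow> real) \<Rightarrow> complex \<Rightarrow> real ^ 2" where
  "grad f z = vector [dx f z, dy f z]"

definition divergence :: "(complex \<Rightarrow> real ^ 2 ^ 2) \<Rightarrow> complex \<Rightarrow> real ^ 2" where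
  "divergence \<tau> z = (\<chi> i. dx (\<lambda>w. \<tau> w $ i $ 1) z + dy (\<lambda>w. \<tau> w $ i $ 2) z)"


subsection \<open>The weak divergence equation\<close>

primrec Ck :: "nat \<Rightarrow> (complex \<Rightarrow> real) \<Rightarrow> bool" where
  "Ck 0 f \<longleftrightarrow> continuous_on UNIV f"
| "Ck (Suc k) f \<longleftrightarrow> (\<forall>z. f differentiable at z) \<and> Ck k (dx f) \<and> Ck k (dy f)"

definition test_function :: "complex set \<Rightarrow> (complex \<Rightarrow> real) \<Rightarrow> bool" where
  "test_function \<Omega> \<phi> \<longleftrightarrow> (\<forall>k. Ck k \<phi>) \<and>
     compact (closure {z. \<phi> z \<noteq> 0}) \<and> closure {z. \<phi> z \<noteq> 0} \<subseteq> \<Omega>"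

definition weakly_divergence_free :: "complex set \<Rightarrow> (complex \<Rightarrow> real ^ 2 ^ 2) \<Rightarrow> bool" where
  "weakly_divergence_free \<Omega> \<tau> \<longleftrightarrow>
     (\<forall>K. compact K \<and> K \<subseteq> \<Omega> \<longrightarrow> \<tau> absolutely_integrable_on K) \<and>
     (\<forall>\<phi>. test_function \<Omega> \<phi> \<longrightarrow>
        set_lebesgue_integral lebesgue \<Omega> (\<lambda>z. \<tau> z *v grad \<phi> z) = 0)"

text \<open>
  The second conjunct already contains the continuity of the traction \<open>\<tau> n\<close> across
  \<open>frontier E\<close>: integrating by parts in each phase, what remains of it is the integral of the
  jump of \<open>\<tau> n\<close> against \<open>\<phi>\<close>, wherever the interface has a normal \<open>n\<close>.
\<close>

definition divergence_free :: "complex set \<Rightarrow> complex set \<Rightarrow> (complex \<Rightarrow> real ^ 2 ^ 2) \<Rightarrow> bool" where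
  "divergence_free \<Omega> E \<tau> \<longleftrightarrow>
     (\<forall>z \<in> \<Omega> - frontier E. \<tau> differentiable at z \<and> divergence \<tau> z = 0) \<and>
     weakly_divergence_free \<Omega> \<tau>"


subsection \<open>Inclusions for conductivity\<close>

text \<open>
  The interface is a Lebesgue null set: otherwise the values of the moduli on it would matter
  in the weak equations.
\<close>

definition inclusion_in_body :: "complex set \<Rightarrow> complex set \<Rightarrow> bool" where
  "inclusion_in_body \<Omega> E \<longleftrightarrow>
     open \<Omega> \<and> simply_connected \<Omega> \<and>
     open E \<and> E \<noteq> {} \<and> simply_connected E \<and>
     compact (closure E) \<and> closure E \<subseteq> \<Omega> \<and> negligible (frontier E)"

definition conductivity_inclusion ::
  "complex set \<Rightarrow> complex set \<Rightarrow> real \<Rightarrow> (complex \<Rightarrow> real) \<Rightarrow> (complex \<Rightarrow> real) \<Rightarrow> bool" where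
  "conductivity_inclusion \<Omega> E \<sigma>1 V W \<longleftrightarrow>
     continuous_on \<Omega> V \<and> continuous_on \<Omega> W \<and>
     (\<lambda>z. (norm (grad V z))\<^sup>2) absolutely_integrable_on (\<Omega> - frontier E) \<and>
     (\<lambda>z. (norm (grad W z))\<^sup>2) absolutely_integrable_on (\<Omega> - frontier E) \<and>
     (\<forall>z\<in>E. V z = Re z \<and> W z = \<sigma>1 * Im z) \<and>
     (\<lambda>z. Complex (V z) (W z)) analytic_on (\<Omega> - closure E)"


subsection \<open>Plane elasticity of a two-phase body\<close>

text \<open>Row \<open>i\<close>, column \<open>j\<close> is the \<open>i\<close>-th partial derivative of the \<open>j\<close>-th component.\<close>

definition displacement_gradient :: "(complex \<Rightarrow> real ^ 2) \<Rightarrow> complex \<Rightarrow> real ^ 2 ^ 2" where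
  "displacement_gradient u z =
     vector [vector [dx (\<lambda>w. u w $ 1) z, dx (\<lambda>w. u w $ 2) z],
             vector [dy (\<lambda>w. u w $ 1) z, dy (\<lambda>w. u w $ 2) z]]"

definition strain :: "(complex \<Rightarrow> real ^ 2) \<Rightarrow> complex \<Rightarrow> real ^ 2 ^ 2" where
  "strain u z =
     (1 / 2) *\<^sub>R (displacement_gradient u z + transpose (displacement_gradient u z))"

definition phase :: "complex set \<Rightarrow> real \<Rightarrow> real \<Rightarrow> complex \<Rightarrow> real" where
  "phase E a b z = (if z \<in> E then a else b)"

definition stress :: "real \<Rightarrow> real \<Rightarrow> real ^ 2 ^ 2 \<Rightarrow> real ^ 2 ^ 2" where
  "stress lam mu \<epsilon> = (lam * trace \<epsilon>) *\<^sub>R mat 1 + (2 * mu) *\<^sub>R \<epsilon>"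

definition elasticity_solution ::
  "complex set \<Rightarrow> complex set \<Rightarrow> real \<Rightarrow> real \<Rightarrow> real \<Rightarrow> real \<Rightarrow>
   (complex \<Rightarrow> real ^ 2) \<Rightarrow> (complex \<Rightarrow> real ^ 2 ^ 2) \<Rightarrow> (complex \<Rightarrow> real ^ 2 ^ 2) \<Rightarrow> bool" where
  "elasticity_solution \<Omega> E lam1 mu1 lam2 mu2 u \<epsilon> \<tau> \<longleftrightarrow>
     continuous_on \<Omega> u \<and>
     (\<forall>z \<in> \<Omega> - frontier E. u differentiable at z \<and> \<epsilon> z = strain u z \<and>
        \<tau> z = stress (phase E lam1 lam2 z) (phase E mu1 mu2 z) (\<epsilon> z)) \<and>
     divergence_free \<Omega> E \<tau>"

text \<open>
  The boundary conditions for which the fields below occur are those satisfied by \<open>u\<close> on the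
  boundary of \<open>\<Omega>\<close>; the condition \<open>e \<noteq> 0\<close> excludes the trivial solution \<open>u = 0\<close>.
\<close>

definition hydrostatic_elastic_inclusion ::
  "complex set \<Rightarrow> complex set \<Rightarrow> real \<Rightarrow> real \<Rightarrow> real \<Rightarrow> real \<Rightarrow> bool" where
  "hydrostatic_elastic_inclusion \<Omega> E lam1 mu1 lam2 mu2 \<longleftrightarrow>
     (\<exists>u \<epsilon> \<tau> e s. elasticity_solution \<Omega> E lam1 mu1 lam2 mu2 u \<epsilon> \<tau> \<and>
        e \<noteq> 0 \<and> (\<forall>z\<in>E. \<epsilon> z = mat e \<and> \<tau> z = mat s))"

end

theory Submission
  imports Defs "HOL-Complex_Analysis.Cauchy_Integral_Formula"
begin

text \<open>
  Since \<open>W = \<sigma>\<^sub>1 y\<close> on the closure of \<open>E\<close>, the formula \<open>V' = -W + (1 + \<sigma>\<^sub>1) y\<close> holds in all of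
  \<open>\<Omega>\<close>, and the Cauchy-Riemann equations make the strain symmetric with constant trace in the
  matrix. The choice of \<open>\<sigma>\<^sub>1\<close> makes the rows of \<open>\<tau>\<close>, up to the constant hydrostatic stress of \<open>E\<close>, the
  rotated gradients of \<open>W - \<sigma>\<^sub>1 y\<close> and \<open>V - x\<close>. Each of these is a continuous function \<open>h\<close>
  vanishing on \<open>closure E\<close> and the imaginary part of a holomorphic \<open>F\<close> elsewhere. No regularity of
  \<open>frontier E\<close> is available to integrate by parts, so \<open>h\<close> itself serves to cut off the
  interface: a rotated gradient multiplied by \<open>\<psi>(h)\<close>, with \<open>\<psi> = 0\<close> near 0, is divergence free and is
  supported away from \<open>closure E\<close>. Letting \<open>\<psi>\<close> tend to 1 off 0 yields the weak equation, because
  \<open>{h = 0, F' \<noteq> 0}\<close> is a null set.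
\<close>

section \<open>Integrals of derivatives of compactly supported functions\<close>

text \<open>The difference quotients of \<open>f\<close> along \<open>v\<close> all have integral 0,
  converge pointwise to \<open>f' x v\<close>, and by the mean value theorem are bounded by any
  bound of \<open>norm (f' x v)\<close>. They live on one common ball, so dominated convergence
  passes to the limit.\<close>

lemma has_integral_derivative_compact_support_UNIV:
  fixes f :: "'a::euclidean_space \<Rightarrow> 'b::euclidean_space"
  assumes K: "compact K"
    and der: "\<And>x. (f has_derivative f' x) (at x)"
    and cont: "continuous_on UNIV (\<lambda>x. f' x v)"
    and zero: "\<And>x. x \<notin> K \<Longrightarrow> f x = 0" "\<And>x. x \<notin> K \<Longrightarrow> f' x v = 0"
  shows "(\<lambda>x. f' x v) absolutely_integrable_on UNIV" "((\<lambda>x. f' x v) has_integral 0) UNIV"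
proof -
  have contf: "continuous_on UNIV f"
    by (meson der continuous_on_eq_continuous_at has_derivative_continuous open_UNIV)
  have [measurable]: "f \<in> borel_measurable borel" "(\<lambda>x. f' x v) \<in> borel_measurable borel"
    using contf cont by (auto intro: borel_measurable_continuous_onI)
  have "integrable lborel (\<lambda>x. indicator K x *\<^sub>R f x)"
    using K contf by (intro borel_integrable_compact) (auto intro: continuous_on_subset)
  moreover have "(\<lambda>x. indicator K x *\<^sub>R f x) = f"
    using zero by (auto simp: indicator_def fun_eq_iff)
  ultimately have intf: "integrable lborel f" by simp
  \<comment> \<open>Translation invariance makes every difference quotient of \<open>f\<close> integrate to 0.\<close>
  have shift: "integrable lborel (\<lambda>x. f (w + x))"
    "integral\<^sup>L lborel (\<lambda>x. f (w + x)) = integral\<^sup>L lborel f" for w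
  proof -
    show "integrable lborel (\<lambda>x. f (w + x))"
      using integrable_distr[of "(+) w" lborel borel f] intf by (simp add: lborel_distr_plus)
    show "integral\<^sup>L lborel (\<lambda>x. f (w + x)) = integral\<^sup>L lborel f"
      using integral_distr[of "(+) w" lborel borel f] by (simp add: lborel_distr_plus)
  qed
  obtain R where R: "K \<subseteq> cball 0 R"
    using compact_imp_bounded[OF K] by (auto simp: bounded_iff cball_def)
  obtain B where B: "\<And>x. x \<in> K \<Longrightarrow> norm (f' x v) \<le> B" "B \<ge> 0"
  proof -
    have "compact ((\<lambda>x. f' x v) ` K)"
      using K cont by (intro compact_continuous_image) (auto intro: continuous_on_subset)
    then obtain B where "\<forall>y\<in>(\<lambda>x. f' x v) ` K. norm y \<le> B"
      using compact_imp_bounded bounded_iff by metis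
    then show ?thesis by (intro that[of "max B 0"]) (force intro: order_trans[OF _ max.cobounded1], simp)
  qed
  have B': "norm (f' x v) \<le> B" for x
    using B zero by (cases "x \<in> K") auto
  define g where "g n x = real (Suc n) *\<^sub>R (f (inverse (real (Suc n)) *\<^sub>R v + x) - f x)" for n x
  \<comment> \<open>The shift \<open>inverse (real (Suc n)) *\<^sub>R v\<close> has length at most
    \<open>norm v\<close>, so outside the enlarged ball both values of \<open>f\<close> in the
    quotient are 0.\<close>
  have bound: "norm (g n x) \<le> B * indicator (cball 0 (R + norm v)) x" for n x
  proof (cases "x \<in> cball 0 (R + norm v)")
    case True
    define t where "t = inverse (real (Suc n))"
    have t: "t > 0" "real (Suc n) * t = 1" by (auto simp: t_def)
    have "\<exists>s\<in>{0<..<t}. norm (f (t *\<^sub>R v + x) - f (0 *\<^sub>R v + x)) \<le> norm (f' (s *\<^sub>R v + x) ((t - 0) *\<^sub>R v))"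
    proof (rule mvt_general[OF t(1), where f = "\<lambda>s. f (s *\<^sub>R v + x)" and f' = "\<lambda>s h. f' (s *\<^sub>R v + x) (h *\<^sub>R v)"])
      show "continuous_on {0..t} (\<lambda>s. f (s *\<^sub>R v + x))"
        by (intro continuous_on_compose2[OF contf] continuous_intros) auto
      show "((\<lambda>s. f (s *\<^sub>R v + x)) has_derivative (\<lambda>h. f' (s *\<^sub>R v + x) (h *\<^sub>R v))) (at s)" for s
        by (rule has_derivative_compose[OF _ der]) (auto intro!: derivative_eq_intros)
    qed
    then obtain s where "norm (f (t *\<^sub>R v + x) - f x) \<le> norm (f' (s *\<^sub>R v + x) (t *\<^sub>R v))"
      by auto
    also have "\<dots> = t * norm (f' (s *\<^sub>R v + x) v)"
      using has_derivative_bounded_linear[OF der] t(1) by (simp add: linear_simps)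
    also have "\<dots> \<le> t * B" using B' t by (intro mult_left_mono) auto
    finally have "real (Suc n) * norm (f (t *\<^sub>R v + x) - f x) \<le> real (Suc n) * (t * B)"
      by (intro mult_left_mono) auto
    also have "\<dots> = B" using t(2) by (metis mult.assoc mult_1)
    finally show ?thesis using True by (simp add: g_def t_def)
  next
    case False
    have "norm (inverse (real (Suc n)) *\<^sub>R v) \<le> norm v"
      by (simp add: field_simps)
    then have "norm (inverse (real (Suc n)) *\<^sub>R v + x) \<ge> norm x - norm v"
      using norm_diff_ineq[of x "inverse (real (Suc n)) *\<^sub>R v"] by (simp add: add.commute)
    then have "x \<notin> cball 0 R" "inverse (real (Suc n)) *\<^sub>R v + x \<notin> cball 0 R"
      using False norm_ge_zero[of v] by (auto simp del: norm_ge_zero)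
    then have "f x = 0" "f (inverse (real (Suc n)) *\<^sub>R v + x) = 0"
      using R zero(1) by blast+
    then show ?thesis using False by (simp add: g_def)
  qed
  have lim: "(\<lambda>n. g n x) \<longlonglongrightarrow> f' x v" for x
  proof -
    have "((\<lambda>s. f (s *\<^sub>R v + x)) has_derivative (\<lambda>h. f' (0 *\<^sub>R v + x) (h *\<^sub>R v))) (at 0)"
      by (rule has_derivative_compose[OF _ der]) (auto intro!: derivative_eq_intros)
    then have "((\<lambda>h. norm (f (h *\<^sub>R v + x) - f x - h *\<^sub>R f' x v) / norm h) \<longlongrightarrow> 0) (at 0)"
      using has_derivative_bounded_linear[OF der] by (simp add: has_derivative_at linear_simps)
    then have "((\<lambda>h. norm ((f (h *\<^sub>R v + x) - f x) /\<^sub>R h - f' x v)) \<longlongrightarrow> 0) (at 0)"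
    proof (rule Lim_transform_eventually)
      have "norm (f (h *\<^sub>R v + x) - f x - h *\<^sub>R f' x v) / norm h
          = norm ((f (h *\<^sub>R v + x) - f x) /\<^sub>R h - f' x v)" if "h \<noteq> 0" for h
      proof -
        have "(f (h *\<^sub>R v + x) - f x) /\<^sub>R h - f' x v
            = (f (h *\<^sub>R v + x) - f x - h *\<^sub>R f' x v) /\<^sub>R h"
          using that by (simp add: scaleR_diff_right)
        then show ?thesis by (simp add: divide_inverse)
      qed
      then show "\<forall>\<^sub>F h in at 0. norm (f (h *\<^sub>R v + x) - f x - h *\<^sub>R f' x v) / norm h
          = norm ((f (h *\<^sub>R v + x) - f x) /\<^sub>R h - f' x v)"
        by (simp add: eventually_at_filter)
    qed
    then have "((\<lambda>h. (f (h *\<^sub>R v + x) - f x) /\<^sub>R h) \<longlongrightarrow> f' x v) (at 0)"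
      by (simp add: tendsto_norm_zero_iff LIM_zero_iff)
    moreover have "filterlim (\<lambda>n. inverse (real (Suc n))) (at 0) sequentially"
      unfolding filterlim_at using LIMSEQ_inverse_real_of_nat by auto
    ultimately have "(\<lambda>n. (f (inverse (real (Suc n)) *\<^sub>R v + x) - f x) /\<^sub>R inverse (real (Suc n))) \<longlonglongrightarrow> f' x v"
      by (rule filterlim_compose)
    then show ?thesis by (simp add: g_def[abs_def])
  qed
  have w: "integrable lborel (\<lambda>x. B * indicator (cball 0 (R + norm v)) x :: real)"
    by (intro integrable_mult_right integrable_real_indicator emeasure_bounded_finite) auto
  have gm: "g n \<in> borel_measurable lborel" for n
    unfolding g_def[abs_def] by measurable
  have int': "integrable lborel (\<lambda>x. f' x v)"
    by (rule integrable_dominated_convergence[where s = g, OF _ gm w]) (use lim bound in auto)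
  have "(\<lambda>n. integral\<^sup>L lborel (g n)) \<longlonglongrightarrow> integral\<^sup>L lborel (\<lambda>x. f' x v)"
    by (rule integral_dominated_convergence[where s = g, OF _ gm w]) (use lim bound in auto)
  moreover have "integral\<^sup>L lborel (g n) = 0" for n
    unfolding g_def[abs_def] by (simp add: shift intf)
  ultimately have "integral\<^sup>L lborel (\<lambda>x. f' x v) = 0"
    by (simp add: LIMSEQ_const_iff)
  then show "((\<lambda>x. f' x v) has_integral 0) UNIV"
    using has_integral_integral_lborel[OF int'] by simp
  show "(\<lambda>x. f' x v) absolutely_integrable_on UNIV"
    using int' by (simp add: set_integrable_def integrable_completion)
qed

lemma has_derivative_zero_on_open:
  assumes "open S" "x \<in> S" "(f has_derivative f') (at x)" "\<And>y. y \<in> S \<Longrightarrow> f y = 0"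
  shows "f' = (\<lambda>_. 0)"
proof -
  have "(f has_derivative (\<lambda>_. 0)) (at x)"
    by (rule has_derivative_transform_within_open[OF has_derivative_const[where c = 0] assms(1,2)])
      (use assms in auto)
  then show ?thesis
    using assms(3) has_derivative_unique by blast
qed

text \<open>Extension by 0 reduces this to the whole space: the open sets \<open>U\<close> and
  \<open>- K\<close> cover everything, and the extension vanishes on \<open>- K\<close>, so it is
  differentiable everywhere.\<close>

lemma has_integral_derivative_compact_support:
  fixes f :: "'a::euclidean_space \<Rightarrow> 'b::euclidean_space"
  assumes U: "open U" and K: "compact K" "K \<subseteq> U"
    and der: "\<And>x. x \<in> U \<Longrightarrow> (f has_derivative f' x) (at x)"
    and cont: "continuous_on U (\<lambda>x. f' x v)"
    and zero: "\<And>x. x \<in> U - K \<Longrightarrow> f x = 0"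
  shows "(\<lambda>x. f' x v) absolutely_integrable_on U" "((\<lambda>x. f' x v) has_integral 0) U"
proof -
  define F where "F x = (if x \<in> U then f x else 0)" for x
  define F' where "F' x = (if x \<in> K then f' x else (\<lambda>_. 0))" for x
  have opK: "open (- K)" using K by (simp add: compact_imp_closed open_Compl)
  have F0: "F x = 0" if "x \<in> - K" for x using that zero by (auto simp: F_def)
  \<comment> \<open>On the open set \<open>U - K\<close> the derivative vanishes along with
    \<open>f\<close>, so cutting it off at \<open>K\<close> or at \<open>U\<close> gives the same
    function.\<close>
  have f'0: "f' x = (\<lambda>_. 0)" if "x \<in> U - K" for x
    by (rule has_derivative_zero_on_open[of "U - K" x f])
      (use that der zero U opK in \<open>auto simp: Diff_eq\<close>)
  have F': "(\<lambda>x. F' x v) = (\<lambda>x. if x \<in> U then f' x v else 0)"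
    using K f'0 by (auto simp: F'_def fun_eq_iff)
  have derF: "(F has_derivative F' x) (at x)" for x
    proof (cases "x \<in> K")
      case True
      then have "(f has_derivative F' x) (at x)" using K der by (auto simp: F'_def)
      then show ?thesis
        by (rule has_derivative_transform_within_open[OF _ U]) (use True K in \<open>auto simp: F_def\<close>)
    next
      case False
      have "(F has_derivative (\<lambda>_. 0)) (at x)"
        by (rule has_derivative_transform_within_open[OF has_derivative_const[where c = 0] opK])
         (use False F0 in auto)
      then show ?thesis using False by (simp add: F'_def)
    qed
  have contF: "continuous_on UNIV (\<lambda>x. F' x v)"
  proof -
    have "continuous_on (U \<union> - K) (\<lambda>x. F' x v)"
    proof (rule continuous_on_open_Un[OF U opK])
      show "continuous_on U (\<lambda>x. F' x v)"
        unfolding F' using cont by (simp cong: continuous_on_cong)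
      show "continuous_on (- K) (\<lambda>x. F' x v)"
        by (rule continuous_on_eq[OF continuous_on_const[of _ 0]]) (auto simp: F'_def)
    qed
    moreover have "U \<union> - K = UNIV" using K by auto
    ultimately show ?thesis by simp
  qed
  have "F x = 0" "F' x v = 0" if "x \<notin> K" for x
    using that F0 by (auto simp: F'_def)
  note has_integral_derivative_compact_support_UNIV[OF K(1) derF contF this]
  then show "(\<lambda>x. f' x v) absolutely_integrable_on U" "((\<lambda>x. f' x v) has_integral 0) U"
    unfolding F' has_integral_restrict_UNIV absolutely_integrable_restrict_UNIV by auto
qed

section \<open>Null preimages and cutoff functions\<close>

text \<open>Where \<open>deriv F z \<noteq> 0\<close> the differential is multiplication by a
  nonzero number, hence injective, and preimages of null sets are null. With the real axis for
  \<open>T\<close> this handles the zero set of \<open>Im F\<close> away from the critical points of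
  \<open>F\<close>.\<close>

lemma negligible_holomorphic_vimage:
  assumes "open U" "F holomorphic_on U" "negligible T"
  shows "negligible {z \<in> U. F z \<in> T \<and> deriv F z \<noteq> 0}"
proof -
  have "negligible {z \<in> {z \<in> U. deriv F z \<noteq> 0}. F z \<in> T}"
  proof (rule negligible_differentiable_vimage[OF assms(3)])
    fix z assume z: "z \<in> {z \<in> U. deriv F z \<noteq> 0}"
    then show "inj ((*) (deriv F z))" by (auto simp: inj_on_def)
    show "(F has_derivative (*) (deriv F z)) (at z within {z \<in> U. deriv F z \<noteq> 0})"
      using z assms holomorphic_derivI[of F U z] has_field_derivative_imp_has_derivative
        has_derivative_at_withinI by blast
  qed
  then show ?thesis by (rule negligible_subset) auto
qed

text \<open>This is the C^1 ingredient of the cutoffs below. At 0 the difference quotient is at most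
  \<open>\<bar>h\<bar>\<close>.\<close>

lemma DERIV_power2_positive_part:
  "((\<lambda>s::real. (max 0 s)\<^sup>2) has_real_derivative 2 * max 0 s) (at s)"
proof -
  consider "s > 0" | "s < 0" | "s = 0" by linarith
  then show ?thesis
  proof cases
    case 1
    have "((\<lambda>s. s\<^sup>2) has_real_derivative 2 * s) (at s)"
      by (auto intro!: derivative_eq_intros)
    then have "((\<lambda>s::real. (max 0 s)\<^sup>2) has_real_derivative 2 * s) (at s)"
      by (rule DERIV_cong_ev[THEN iffD1, rotated -1])
        (use 1 in \<open>auto intro: eventually_mono[OF eventually_nhds_in_open[of "{0<..}"]]\<close>)
    then show ?thesis using 1 by simp
  next
    case 2
    have "((\<lambda>s. 0) has_real_derivative 0) (at s)" by simp
    then have "((\<lambda>s::real. (max 0 s)\<^sup>2) has_real_derivative 0) (at s)"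
      by (rule DERIV_cong_ev[THEN iffD1, rotated -1])
        (use 2 in \<open>auto intro: eventually_mono[OF eventually_nhds_in_open[of "{..<0}"]]\<close>)
    then show ?thesis using 2 by simp
  next
    case 3
    have "((\<lambda>h::real. (max 0 h)\<^sup>2 / h) \<longlongrightarrow> 0) (at 0)"
    proof (rule Lim_null_comparison)
      show "\<forall>\<^sub>F h in at 0. norm ((max 0 h)\<^sup>2 / h) \<le> \<bar>h\<bar>"
        by (rule always_eventually) (auto simp: max_def power2_eq_square)
      show "((\<lambda>h::real. \<bar>h\<bar>) \<longlongrightarrow> 0) (at 0)"
        by (auto intro!: tendsto_eq_intros)
    qed
    then show ?thesis using 3 by (simp add: DERIV_def)
  qed
qed

lemma le_1_plus_power2:
  fixes m :: real
  assumes "m \<ge> 0"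
  shows "m \<le> 1 + m\<^sup>2"
  using zero_le_power2[of "m - 1"] assms by (simp add: power2_diff)

text \<open>An explicit choice is \<open>1 - 1 / (1 + m^2)\<close> with \<open>m\<close> the
  positive part of \<open>((n + 1) t)^2 - 1\<close>. It vanishes exactly where \<open>m = 0\<close>,
  that is for \<open>\<bar>t\<bar> \<le> 1 / (n + 1)\<close>, and tends to 1 for
  \<open>t \<noteq> 0\<close> because \<open>m\<close> then tends to infinity. Squaring
  \<open>m\<close> makes it C^1.\<close>

lemma C1_cutoff_sequence:
  obtains \<psi> \<psi>' :: "nat \<Rightarrow> real \<Rightarrow> real"
  where "\<And>n t. (\<psi> n has_real_derivative \<psi>' n t) (at t)"
    and "\<And>n. continuous_on UNIV (\<psi>' n)"
    and "\<And>n t. \<bar>t\<bar> \<le> inverse (real (Suc n)) \<Longrightarrow> \<psi> n t = 0"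
    and "\<And>n t. \<bar>\<psi> n t\<bar> \<le> 1"
    and "\<And>t. t \<noteq> 0 \<Longrightarrow> (\<lambda>n. \<psi> n t) \<longlonglongrightarrow> 1"
proof -
  define s where "s n t = (real (Suc n) * t)\<^sup>2 - 1" for n t
  define s' where "s' n t = 2 * (real (Suc n) * t) * real (Suc n)" for n t
  define \<psi> where "\<psi> n t = 1 - inverse (1 + (max 0 (s n t))\<^sup>2)" for n t
  define \<psi>' where "\<psi>' n t = inverse ((1 + (max 0 (s n t))\<^sup>2)\<^sup>2) * (2 * max 0 (s n t) * s' n t)" for n t
  have pos: "1 + (max 0 r)\<^sup>2 > 0" for r :: real by (simp add: add_pos_nonneg)
  have ds: "(s n has_real_derivative s' n t) (at t)" for n t
    unfolding s_def[abs_def] s'_def by (auto intro!: derivative_eq_intros)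
  show ?thesis
  proof
    fix n t
    have "((\<lambda>t. (max 0 (s n t))\<^sup>2) has_real_derivative 2 * max 0 (s n t) * s' n t) (at t)"
      by (rule DERIV_chain2[OF DERIV_power2_positive_part ds])
    from DERIV_diff[OF DERIV_const DERIV_inverse'[OF DERIV_add[OF DERIV_const this]]]
    have "((\<lambda>t. 1 - inverse (1 + (max 0 (s n t))\<^sup>2)) has_real_derivative
        0 - - (inverse (1 + (max 0 (s n t))\<^sup>2) * (0 + 2 * max 0 (s n t) * s' n t) * inverse (1 + (max 0 (s n t))\<^sup>2))) (at t)"
      using pos[of "s n t"] by (metis less_irrefl)
    then show "(\<psi> n has_real_derivative \<psi>' n t) (at t)"
      unfolding \<psi>_def[abs_def] \<psi>'_def by (rule DERIV_cong) (simp add: power2_eq_square mult_ac)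
    show "continuous_on UNIV (\<psi>' n)"
      unfolding \<psi>'_def s_def s'_def
      by (intro continuous_intros) (use pos in \<open>auto simp: less_imp_neq[symmetric]\<close>)
    show "\<psi> n t = 0" if "\<bar>t\<bar> \<le> inverse (real (Suc n))"
    proof -
      have "\<bar>real (Suc n) * t\<bar> \<le> 1" using that unfolding abs_mult abs_of_nat by (simp add: field_simps)
      then have "s n t \<le> 0" by (simp add: s_def abs_square_le_1)
      then show ?thesis by (simp add: \<psi>_def)
    qed
    have "0 < inverse (1 + (max 0 (s n t))\<^sup>2)" "inverse (1 + (max 0 (s n t))\<^sup>2) \<le> 1"
      using pos by (auto simp: inverse_le_1_iff)
    then show "\<bar>\<psi> n t\<bar> \<le> 1" unfolding \<psi>_def by linarith
  next
    fix t :: real assume t: "t \<noteq> 0"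
    have "filterlim (\<lambda>n. real (Suc n) * \<bar>t\<bar>) at_top sequentially"
      using t by (intro filterlim_at_top_mult_tendsto_pos[OF tendsto_const]
         filterlim_compose[OF filterlim_real_sequentially filterlim_Suc]) auto
    then have "filterlim (\<lambda>n. (real (Suc n) * \<bar>t\<bar>)\<^sup>2) at_top sequentially"
      by (intro filterlim_pow_at_top) auto
    then have "filterlim (\<lambda>n. - 1 + (real (Suc n) * \<bar>t\<bar>)\<^sup>2) at_top sequentially"
      by (rule filterlim_tendsto_add_at_top[OF tendsto_const])
    then have "filterlim (\<lambda>n. 1 + (max 0 (s n t))\<^sup>2) at_top sequentially"
    proof (rule filterlim_at_top_mono, intro always_eventually allI)
      fix n
      have "r \<le> 1 + (max 0 r)\<^sup>2" for r :: real
        by (meson le_1_plus_power2 max.cobounded1 max.cobounded2 order_trans)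
      from this[of "s n t"] show "- 1 + (real (Suc n) * \<bar>t\<bar>)\<^sup>2 \<le> 1 + (max 0 (s n t))\<^sup>2"
        by (simp add: s_def power_mult_distrib)
    qed
    then have "(\<lambda>n. inverse (1 + (max 0 (s n t))\<^sup>2)) \<longlonglongrightarrow> 0"
      by (rule tendsto_inverse_0_at_top)
    then have "(\<lambda>n. 1 - inverse (1 + (max 0 (s n t))\<^sup>2)) \<longlonglongrightarrow> 1 - 0"
      by (intro tendsto_intros)
    then show "(\<lambda>n. \<psi> n t) \<longlonglongrightarrow> 1" by (simp add: \<psi>_def)
  qed
qed

section \<open>Weak Cauchy-Riemann equations off a closed set\<close>

text \<open>
  As \<open>\<psi>\<close> vanishes near 0, \<open>\<phi> \<psi>(h) F'\<close> has compact support in \<open>\<Omega> - C\<close>. In the real part of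
  \<open>(\<partial>x + \<i> \<partial>y) (\<phi> \<psi>(h) F')\<close> the term with \<open>\<psi>'(h)\<close> drops out, because
  \<open>h_x + \<i> h_y = \<i> cnj F'\<close> for \<open>h = Im F\<close>.
\<close>

lemma has_integral_cutoff_weak_Cauchy_Riemann:
  fixes F :: "complex \<Rightarrow> complex" and h \<phi> :: "complex \<Rightarrow> real" and \<psi> \<psi>' :: "real \<Rightarrow> real"
  assumes \<Omega>: "open \<Omega>" and C: "closed C" and F: "F holomorphic_on \<Omega> - C"
    and h: "continuous_on \<Omega> h" "\<And>z. z \<in> \<Omega> \<inter> C \<Longrightarrow> h z = 0" "\<And>z. z \<in> \<Omega> - C \<Longrightarrow> h z = Im (F z)"
    and K: "compact K" "K \<subseteq> \<Omega>"
    and \<phi>: "\<And>z. (\<phi> has_derivative \<phi>' z) (at z)" "\<And>v. continuous_on UNIV (\<lambda>z. \<phi>' z v)"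
      "\<And>z. z \<notin> K \<Longrightarrow> \<phi> z = 0"
    and \<psi>: "\<And>t. (\<psi> has_real_derivative \<psi>' t) (at t)" "continuous_on UNIV \<psi>'"
      "\<And>t. \<bar>t\<bar> \<le> \<delta> \<Longrightarrow> \<psi> t = 0" "\<delta> > 0"
  shows "((\<lambda>z. \<psi> (h z) * Re (Complex (\<phi>' z 1) (\<phi>' z \<i>) * deriv F z)) has_integral 0) (\<Omega> - C)"
proof -
  define U where "U = \<Omega> - C"
  have U: "open U" using \<Omega> C by (simp add: U_def open_Diff)
  define G where "G = deriv F"
  have F': "F holomorphic_on U" using F by (simp add: U_def)
  have G: "G holomorphic_on U" unfolding G_def by (rule holomorphic_deriv[OF F' U])
  define \<Phi> where "\<Phi> z = complex_of_real (\<phi> z * \<psi> (h z)) * G z" for z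
  define \<Phi>' where "\<Phi>' z v = complex_of_real (\<phi>' z v * \<psi> (h z) + \<phi> z * (\<psi>' (h z) * Im (G z * v))) * G z
      + complex_of_real (\<phi> z * \<psi> (h z)) * (deriv G z * v)" for z v
  \<comment> \<open>Since \<open>h = 0\<close> on \<open>C\<close>, the condition
    \<open>\<bar>h\<bar> \<ge> \<delta>\<close> keeps this set off \<open>C\<close>. By continuity
    of \<open>h\<close> it is closed, hence a compact subset of \<open>U\<close>, and
    \<open>\<Phi>\<close> vanishes on the rest of \<open>U\<close>.\<close>
  define K' where "K' = K \<inter> h -` {t. \<bar>t\<bar> \<ge> \<delta>}"
  have "closed K'" unfolding K'_def
  proof (rule continuous_closed_preimage)
    show "continuous_on K h" using h(1) K(2) continuous_on_subset by blast
    show "closed {t::real. \<delta> \<le> \<bar>t\<bar>}" by (intro closed_Collect_le continuous_intros)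
  qed (use K compact_imp_closed in auto)
  then have "compact K'"
    using K(1) by (metis K'_def compact_Int_closed inf.right_idem inf_commute inf_left_idem)
  moreover have "K' \<subseteq> U"
    using K(2) h(2) \<psi>(4) by (force simp: K'_def U_def)
  moreover have "(\<Phi> has_derivative \<Phi>' z) (at z)" if "z \<in> U" for z
  proof -
    have "(F has_derivative (\<lambda>v. G z * v)) (at z)"
      using holomorphic_derivI[OF F' U that] by (simp add: G_def has_field_derivative_def)
    then have "((\<lambda>z. Im (F z)) has_derivative (\<lambda>v. Im (G z * v))) (at z)"
      by (rule has_derivative_Im)
    then have dh: "(h has_derivative (\<lambda>v. Im (G z * v))) (at z)"
      by (rule has_derivative_transform_within_open[OF _ U that]) (use h(3) U_def in auto)
    have "((\<lambda>z. \<psi> (h z)) has_derivative (\<lambda>v. \<psi>' (h z) * Im (G z * v))) (at z)"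
      by (rule has_derivative_compose[OF dh \<psi>(1)[unfolded has_field_derivative_def]])
    moreover have "(G has_derivative (\<lambda>v. deriv G z * v)) (at z)"
      using holomorphic_derivI[OF G U that] by (simp add: has_field_derivative_def)
    ultimately show ?thesis
      unfolding \<Phi>_def[abs_def] \<Phi>'_def[abs_def]
      by (auto intro!: derivative_eq_intros \<phi>(1) simp: algebra_simps fun_eq_iff)
  qed
  moreover have "continuous_on U (\<lambda>z. \<Phi>' z v)" for v
  proof -
    have "continuous_on U \<phi>"
      by (meson \<phi>(1) continuous_at_imp_continuous_on has_derivative_continuous)
    moreover have ch: "continuous_on U h" using h(1) by (rule continuous_on_subset) (auto simp: U_def)
    moreover have "continuous_on UNIV \<psi>"
      using \<psi>(1) by (meson DERIV_isCont continuous_at_imp_continuous_on)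
    then have "continuous_on U (\<lambda>z. \<psi> (h z))" by (rule continuous_on_compose2[OF _ ch]) auto
    moreover have "continuous_on U (\<lambda>z. \<psi>' (h z))" by (rule continuous_on_compose2[OF \<psi>(2) ch]) auto
    moreover have "continuous_on U G" "continuous_on U (deriv G)"
      using G holomorphic_deriv[OF G U] by (auto intro: holomorphic_on_imp_continuous_on)
    moreover have "continuous_on U (\<lambda>z. \<phi>' z v)"
      using \<phi>(2) continuous_on_subset by blast
    ultimately show ?thesis unfolding \<Phi>'_def by (intro continuous_intros)
  qed
  moreover have "\<Phi> z = 0" if "z \<in> U - K'" for z
    using that \<phi>(3)[of z] \<psi>(3)[of "h z"] by (auto simp: \<Phi>_def K'_def)
  ultimately have int: "((\<lambda>z. \<Phi>' z v) has_integral 0) U" for v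
    using has_integral_derivative_compact_support[OF U, of K' \<Phi> \<Phi>' v] by blast
  have "((\<lambda>z. \<Phi>' z 1 + \<i> * \<Phi>' z \<i>) has_integral 0 + \<i> * 0) U"
    by (intro has_integral_add has_integral_mult_right int)
  then have "((\<lambda>z. Re (\<Phi>' z 1 + \<i> * \<Phi>' z \<i>)) has_integral 0) U"
    using has_integral_linear[OF _ bounded_linear_Re] by (force simp: o_def)
  \<comment> \<open>The \<open>deriv G\<close> terms cancel because
    \<open>1 + \<i> * \<i> = 0\<close>; the \<open>\<psi>'\<close> terms add up to
    \<open>\<i> * \<phi> z * \<psi>' (h z) * (norm (G z))^2\<close>, which has no real part.\<close>
  moreover have "Re (\<Phi>' z 1 + \<i> * \<Phi>' z \<i>) = \<psi> (h z) * Re (Complex (\<phi>' z 1) (\<phi>' z \<i>) * G z)" for z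
    by (simp add: \<Phi>'_def algebra_simps)
  ultimately show ?thesis by (simp add: U_def G_def)
qed

text \<open>The integrand is the scalar product of the gradient of \<open>\<phi>\<close> with
  \<open>(h_y, - h_x)\<close>, so this is the weak divergence equation for the rotated gradient of
  \<open>h\<close>. The cutoff is removed by dominated convergence, the majorant being a bound for
  the gradient of \<open>\<phi>\<close> times \<open>norm (deriv F z)\<close> on
  \<open>K - C\<close>.\<close>

lemma has_integral_weak_Cauchy_Riemann:
  fixes F :: "complex \<Rightarrow> complex" and h \<phi> :: "complex \<Rightarrow> real"
  assumes \<Omega>: "open \<Omega>" and C: "closed C" and F: "F holomorphic_on \<Omega> - C"
    and h: "continuous_on \<Omega> h" "\<And>z. z \<in> \<Omega> \<inter> C \<Longrightarrow> h z = 0" "\<And>z. z \<in> \<Omega> - C \<Longrightarrow> h z = Im (F z)"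
    and K: "compact K" "K \<subseteq> \<Omega>"
    and \<phi>: "\<And>z. (\<phi> has_derivative \<phi>' z) (at z)" "\<And>v. continuous_on UNIV (\<lambda>z. \<phi>' z v)"
      "\<And>z. z \<notin> K \<Longrightarrow> \<phi> z = 0"
    and int: "deriv F absolutely_integrable_on K - C"
  shows "(\<lambda>z. Re (Complex (\<phi>' z 1) (\<phi>' z \<i>) * deriv F z)) absolutely_integrable_on \<Omega> - C"
    and "((\<lambda>z. Re (Complex (\<phi>' z 1) (\<phi>' z \<i>) * deriv F z)) has_integral 0) (\<Omega> - C)"
proof -
  define U where "U = \<Omega> - C"
  have U: "open U" using \<Omega> C by (simp add: U_def open_Diff)
  have F': "F holomorphic_on U" using F by (simp add: U_def)
  define I where "I z = Re (Complex (\<phi>' z 1) (\<phi>' z \<i>) * deriv F z)" for z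
  have cont1: "continuous_on S (\<lambda>z. Complex (\<phi>' z 1) (\<phi>' z \<i>))" for S
    using \<phi>(2) continuous_on_subset by (intro continuous_intros) blast+
  have cont: "continuous_on U I"
    unfolding I_def[abs_def]
    by (intro continuous_intros cont1 holomorphic_on_imp_continuous_on holomorphic_deriv F' U)
  obtain B where B: "\<And>z. z \<in> K \<Longrightarrow> norm (Complex (\<phi>' z 1) (\<phi>' z \<i>)) \<le> B"
    using compact_imp_bounded[OF compact_continuous_image[OF cont1 K(1)]]
    by (auto simp: bounded_iff)
  have \<phi>'0: "\<phi>' z = (\<lambda>_. 0)" if "z \<notin> K" for z
    by (rule has_derivative_zero_on_open[OF _ _ \<phi>(1), of "- K"])
      (use that K(1) \<phi>(3) in \<open>auto simp: compact_imp_closed\<close>)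
  define g where "g z = (if z \<in> K - C then B * norm (deriv F z) else 0)" for z
  have "(\<lambda>z. B * norm (deriv F z)) integrable_on K - C"
    using int by (intro integrable_on_mult_right) (auto simp: absolutely_integrable_on_def)
  moreover have "(K - C) \<inter> U = K - C" using K(2) by (auto simp: U_def)
  ultimately have "g integrable_on U"
    by (simp add: g_def[abs_def] integrable_restrict_Int del: Diff_iff)
  have bound: "norm (I z) \<le> g z" if "z \<in> U" for z
  proof (cases "z \<in> K")
    case True
    have "norm (I z) \<le> norm (Complex (\<phi>' z 1) (\<phi>' z \<i>)) * norm (deriv F z)"
      unfolding I_def using abs_Re_le_cmod by (metis norm_mult real_norm_def)
    also have "\<dots> \<le> B * norm (deriv F z)" using B[OF True] by (intro mult_right_mono) auto
    finally show ?thesis using that True by (auto simp: g_def U_def)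
  qed (auto simp: I_def \<phi>'0 g_def complex_eq_iff)
  have "I absolutely_integrable_on U"
    by (rule measurable_bounded_by_integrable_imp_absolutely_integrable[OF _ _ \<open>g integrable_on U\<close> bound])
      (use U cont in \<open>auto intro!: continuous_imp_measurable_on_sets_lebesgue\<close>)
  then show "(\<lambda>z. Re (Complex (\<phi>' z 1) (\<phi>' z \<i>) * deriv F z)) absolutely_integrable_on \<Omega> - C"
    by (simp add: I_def[abs_def] U_def)
  obtain \<psi> \<psi>' where \<psi>: "\<And>n t. (\<psi> n has_real_derivative \<psi>' n t) (at t)"
      "\<And>n. continuous_on UNIV (\<psi>' n)"
      "\<And>n t. \<bar>t\<bar> \<le> inverse (real (Suc n)) \<Longrightarrow> \<psi> n t = 0"
      "\<And>n t. \<bar>\<psi> n t\<bar> \<le> 1"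
      "\<And>t. t \<noteq> 0 \<Longrightarrow> (\<lambda>n. \<psi> n t) \<longlonglongrightarrow> 1"
    using C1_cutoff_sequence by blast
  have zero: "((\<lambda>z. \<psi> n (h z) * I z) has_integral 0) U" for n
    unfolding I_def U_def
    by (rule has_integral_cutoff_weak_Cauchy_Riemann
        [where \<psi>' = "\<psi>' n" and K = K and \<phi> = \<phi> and \<delta> = "inverse (real (Suc n))"])
       (use assms \<psi> in auto)
  \<comment> \<open>The limit of the cut-off integrands is \<open>J\<close>; it differs from \<open>I\<close> only where \<open>h = 0\<close> and \<open>F' \<noteq> 0\<close>.\<close>
  define J where "J z = (if h z = 0 then 0 else I z)" for z
  have 1: "(\<lambda>z. \<psi> n (h z) * I z) integrable_on U" for n using zero by blast
  have 2: "norm (\<psi> n (h z) * I z) \<le> g z" if "z \<in> U" for n z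
    using mult_mono[OF \<psi>(4) bound[OF that]] by (simp add: abs_mult)
  have 3: "(\<lambda>n. \<psi> n (h z) * I z) \<longlonglongrightarrow> J z" for z
  proof (cases "h z = 0")
    case False
    then have "(\<lambda>n. \<psi> n (h z) * I z) \<longlonglongrightarrow> 1 * I z" by (intro tendsto_intros \<psi>(5))
    then show ?thesis using False by (simp add: J_def)
  qed (use \<psi>(3) in \<open>simp add: J_def\<close>)
  note dom = dominated_convergence[OF 1 \<open>g integrable_on U\<close> 2 3]
  have "integral U J = 0"
    using dom(2) zero[THEN integral_unique] by (simp add: LIMSEQ_const_iff)
  then have "(J has_integral 0) U"
    using dom(1) by (simp add: has_integral_iff)
  \<comment> \<open>Here \<open>\<i> \<bullet> w = Im w\<close>, so this is the set where
    \<open>h = 0\<close> without the critical points of \<open>F\<close>; at those \<open>I\<close>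
    is itself 0.\<close>
  moreover have "negligible {z \<in> U. F z \<in> {w. \<i> \<bullet> w = 0} \<and> deriv F z \<noteq> 0}"
    by (intro negligible_holomorphic_vimage U F' negligible_hyperplane) auto
  ultimately have "(I has_integral 0) U"
    by (rule has_integral_spike[rotated -1]) (use h(3) in \<open>auto simp: I_def J_def U_def\<close>)
  then show "((\<lambda>z. Re (Complex (\<phi>' z 1) (\<phi>' z \<i>) * deriv F z)) has_integral 0) (\<Omega> - C)"
    by (simp add: I_def[abs_def] U_def)
qed

section \<open>Partial derivatives, test functions and set integrals\<close>

lemma dx_dy_eq:
  assumes "(f has_derivative f') (at z)"
  shows "dx f z = f' 1" "dy f z = f' \<i>"
  using frechet_derivative_at[OF assms] by (simp_all add: dx_def dy_def)

lemma frechet_derivative_eq_dx_dy: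
  assumes "f differentiable (at z)"
  shows "frechet_derivative f (at z) v = Re v * dx f z + Im v * dy f z"
proof -
  have lin: "linear (frechet_derivative f (at z))" by (rule linear_frechet_derivative[OF assms])
  have "frechet_derivative f (at z) v = frechet_derivative f (at z) (Re v *\<^sub>R 1 + Im v *\<^sub>R \<i>)"
    by (rule arg_cong) (simp add: complex_eq_iff)
  then show ?thesis by (simp only: linear_add[OF lin] linear_scale[OF lin] dx_def dy_def) simp
qed

lemma test_functionD:
  assumes "test_function \<Omega> \<phi>"
  obtains K \<phi>' where "compact K" "K \<subseteq> \<Omega>" "\<And>z. (\<phi> has_derivative \<phi>' z) (at z)"
    "\<And>v. continuous_on UNIV (\<lambda>z. \<phi>' z v)" "\<And>z. z \<notin> K \<Longrightarrow> \<phi> z = 0"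
    "\<And>z. \<phi>' z 1 = dx \<phi> z" "\<And>z. \<phi>' z \<i> = dy \<phi> z"
proof
  have "Ck (Suc 0) \<phi>" using assms test_function_def by blast
  then have *: "\<And>z. \<phi> differentiable (at z)" "continuous_on UNIV (dx \<phi>)" "continuous_on UNIV (dy \<phi>)"
    by auto
  let ?K = "closure {z. \<phi> z \<noteq> 0}"
  show "compact ?K" "?K \<subseteq> \<Omega>" using assms by (auto simp: test_function_def)
  show "(\<phi> has_derivative frechet_derivative \<phi> (at z)) (at z)" for z
    using * frechet_derivative_works by blast
  show "continuous_on UNIV (\<lambda>z. frechet_derivative \<phi> (at z) v)" for v
    unfolding frechet_derivative_eq_dx_dy[OF *(1)] by (intro continuous_intros *)
  show "\<phi> z = 0" if "z \<notin> ?K" for z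
    using that subsetD[OF closure_subset, of z "{z. \<phi> z \<noteq> 0}"] by auto
qed (simp_all add: dx_def dy_def)

text \<open>Leads from the gauge integral to the Bochner integral, whose rules for sums and
  multiples carry integrability and value together.\<close>

lemma has_bochner_integral_set_lebesgueI:
  fixes f :: "'a::euclidean_space \<Rightarrow> 'b::euclidean_space"
  assumes "f absolutely_integrable_on S" "(f has_integral y) S"
  shows "has_bochner_integral lebesgue (\<lambda>x. indicator S x *\<^sub>R f x) y"
  using assms set_lebesgue_integral_eq_integral[OF assms(1)]
  by (simp add: has_bochner_integral_iff set_integrable_def set_lebesgue_integral_def integral_unique)

lemma vector_2_axis: "(vector [a, b] :: real ^ 2) = a *\<^sub>R axis 1 1 + b *\<^sub>R axis 2 1"
  by (simp add: vec_eq_iff forall_2 axis_def)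

lemma mat_2_eq: "(mat a :: real ^ 2 ^ 2) = vector [vector [a, 0], vector [0, a]]"
  by (simp add: vec_eq_iff forall_2 mat_def)

section \<open>The stress in the matrix phase\<close>

text \<open>
  The stress in the matrix phase as a function of \<open>w = f'(z)\<close>, \<open>f = V + \<i> W\<close>, with \<open>s\<close> the hydrostatic
  stress in the inclusion. Its rows minus those of \<open>mat s\<close> are \<open>2 \<mu>\<close> times the rotated gradients of
  \<open>W - \<sigma> y\<close> and \<open>V - x\<close>, functions that vanish on the closure of the inclusion.
\<close>

definition matrix_stress :: "real \<Rightarrow> real \<Rightarrow> real \<Rightarrow> complex \<Rightarrow> real ^ 2 ^ 2" where
  "matrix_stress s mu \<sigma> w = mat s + (2 * mu) *\<^sub>R vector [vector [Re w - \<sigma>, - Im w], vector [- Im w, 1 - Re w]]"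

text \<open>Being real-affine in \<open>w\<close>, the stress inherits integrability and
  differentiability from the real and imaginary parts of \<open>w\<close>.\<close>

lemma matrix_stress_affine:
  "matrix_stress s mu \<sigma> w = matrix_stress s mu \<sigma> 0 + Re w *\<^sub>R (2 * mu) *\<^sub>R vector [vector [1, 0], vector [0, - 1]]
     + Im w *\<^sub>R (2 * mu) *\<^sub>R vector [vector [0, - 1], vector [- 1, 0]]"
  by (simp add: matrix_stress_def vec_eq_iff forall_2 algebra_simps)

text \<open>Brings both rows into the form of \<open>has_integral_weak_Cauchy_Riemann\<close>: for
  \<open>w = f'(z)\<close> the second factors are the derivatives of \<open>f - \<sigma> z\<close>
  and \<open>\<i> (f - z)\<close>, with imaginary parts \<open>W - \<sigma> y\<close> and
  \<open>V - x\<close>.\<close>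

lemma matrix_stress_matrix_vector:
  "matrix_stress s mu \<sigma> w *v vector [a, b] = s *\<^sub>R vector [a, b] +
     (2 * mu) *\<^sub>R vector [Re (Complex a b * (w - of_real \<sigma>)), Re (Complex a b * (\<i> * (w - 1)))]"
  by (simp add: matrix_stress_def mat_2_eq vec_eq_iff forall_2 matrix_vector_mult_def sum_2 algebra_simps)

lemma continuous_eq_on_closure:
  fixes f g :: "'a::topological_space \<Rightarrow> real"
  assumes "continuous_on (closure S) f" "continuous_on (closure S) g" "\<And>x. x \<in> S \<Longrightarrow> f x = g x" "x \<in> closure S"
  shows "f x = g x"
  using continuous_constant_on_closure[OF continuous_on_diff[OF assms(1,2)], of 0 x] assms by simp

text \<open>In each row the two partial derivatives cancel by the Cauchy-Riemann equations for
  \<open>G\<close>, which will be \<open>f'\<close>.\<close>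

lemma divergence_matrix_stress:
  assumes "open D" "G holomorphic_on D" "z \<in> D" "\<And>w. w \<in> D \<Longrightarrow> \<tau> w = matrix_stress s mu \<sigma> (G w)"
  shows "\<tau> differentiable (at z)" "divergence \<tau> z = 0"
proof -
  define M1 M2 :: "real ^ 2 ^ 2" where
    "M1 = (2 * mu) *\<^sub>R vector [vector [1, 0], vector [0, - 1]]" and
    "M2 = (2 * mu) *\<^sub>R vector [vector [0, - 1], vector [- 1, 0]]"
  have "(G has_derivative (\<lambda>v. deriv G z * v)) (at z)"
    using holomorphic_derivI[OF assms(2,1,3)] by (simp add: has_field_derivative_def)
  then have "((\<lambda>w. matrix_stress s mu \<sigma> 0 + Re (G w) *\<^sub>R M1 + Im (G w) *\<^sub>R M2) has_derivative
       (\<lambda>v. Re (deriv G z * v) *\<^sub>R M1 + Im (deriv G z * v) *\<^sub>R M2)) (at z)"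
    by (auto intro!: derivative_eq_intros simp del: times_complex.sel)
  then have d: "(\<tau> has_derivative (\<lambda>v. Re (deriv G z * v) *\<^sub>R M1 + Im (deriv G z * v) *\<^sub>R M2)) (at z)"
    by (rule has_derivative_transform_within_open[OF _ assms(1,3)])
      (simp add: assms(4) matrix_stress_affine[of s mu \<sigma> "G _"] M1_def M2_def)
  show "\<tau> differentiable (at z)" using d differentiable_def by blast
  have "((\<lambda>w. \<tau> w $ i $ j) has_derivative
      (\<lambda>v. (Re (deriv G z * v) *\<^sub>R M1 + Im (deriv G z * v) *\<^sub>R M2) $ i $ j)) (at z)" for i j
    by (intro bounded_linear.has_derivative[OF bounded_linear_vec_nth] d)
  note this[THEN dx_dy_eq(1)] this[THEN dx_dy_eq(2)]
  then show "divergence \<tau> z = 0"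
    by (simp add: divergence_def vec_eq_iff forall_2 M1_def M2_def)
qed

section \<open>The weak equation across the interface\<close>

text \<open>The stress is split into \<open>mat s\<close> on all of \<open>\<Omega>\<close>, which
  contributes a multiple of the integral of \<open>grad \<phi>\<close>, hence 0, and a remainder
  supported off \<open>closure E\<close>, whose rows are rotated gradients.\<close>

lemma weakly_divergence_free_two_phase:
  fixes f :: "complex \<Rightarrow> complex" and \<tau> :: "complex \<Rightarrow> real ^ 2 ^ 2"
  assumes \<Omega>: "open \<Omega>" and E: "open E" "closure E \<subseteq> \<Omega>" "negligible (frontier E)"
    and f: "f holomorphic_on \<Omega> - closure E" "continuous_on \<Omega> f"
      "\<And>z. z \<in> E \<Longrightarrow> f z = Complex (Re z) (\<sigma> * Im z)"
    and int: "\<And>K. compact K \<Longrightarrow> K \<subseteq> \<Omega> \<Longrightarrow> deriv f absolutely_integrable_on K - closure E"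
    and \<tau>: "\<And>z. z \<in> E \<Longrightarrow> \<tau> z = mat s"
      "\<And>z. z \<in> \<Omega> - closure E \<Longrightarrow> \<tau> z = matrix_stress s mu \<sigma> (deriv f z)"
  shows "weakly_divergence_free \<Omega> \<tau>"
proof -
  define C where "C = closure E"
  have C: "closed C" by (simp add: C_def)
  have fr: "frontier E = C - E" using E by (simp add: frontier_def C_def interior_open)
  have D: "open (\<Omega> - C)" using \<Omega> C by (rule open_Diff)
  \<comment> \<open>Continuity carries the values of \<open>f\<close> from \<open>E\<close> to its
    frontier, so that both functions \<open>h\<close> used below vanish on all of
    \<open>C\<close>.\<close>
  have fC: "f z = Complex (Re z) (\<sigma> * Im z)" if "z \<in> C" for z
  proof -
    have c: "continuous_on C f" using f(2) E(2) C_def continuous_on_subset by blast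
    have "Re (f z) = Re z"
      by (rule continuous_eq_on_closure[of E]) (use that c f(3) in \<open>auto intro!: continuous_intros simp: C_def\<close>)
    moreover have "Im (f z) = \<sigma> * Im z"
      by (rule continuous_eq_on_closure[of E]) (use that c f(3) in \<open>auto intro!: continuous_intros simp: C_def\<close>)
    ultimately show ?thesis by (simp add: complex_eq_iff)
  qed
  have df: "(f has_field_derivative deriv f z) (at z)" if "z \<in> \<Omega> - C" for z
    using holomorphic_derivI[OF f(1) D[unfolded C_def]] that by (simp add: C_def)
  have 1: "\<tau> absolutely_integrable_on K" if K: "compact K" "K \<subseteq> \<Omega>" for K
  proof -
    have "(\<lambda>z. mat s :: real ^ 2 ^ 2) absolutely_integrable_on K \<inter> C"
      by (intro absolutely_integrable_on_const lmeasurable_compact compact_Int_closed K C)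
    \<comment> \<open>The values of \<open>\<tau>\<close> on the frontier are unspecified; they are
      discarded as a null set.\<close>
    then have inner: "\<tau> absolutely_integrable_on K \<inter> C"
      by (rule absolutely_integrable_spike[OF _ E(3)]) (use \<tau>(1) fr in auto)
    have "K - C \<in> lmeasurable"
      by (intro fmeasurable_Diff lmeasurable_compact K) (use C in auto)
    then have const: "(\<lambda>z. matrix_stress s mu \<sigma> 0) absolutely_integrable_on K - C"
      by (rule absolutely_integrable_on_const)
    have f': "deriv f absolutely_integrable_on K - C"
      using int[OF K] by (simp add: C_def)
    have "(\<lambda>z. Re (deriv f z)) absolutely_integrable_on K - C"
      "(\<lambda>z. Im (deriv f z)) absolutely_integrable_on K - C"
      using absolutely_integrable_linear[OF f' bounded_linear_Re]
        absolutely_integrable_linear[OF f' bounded_linear_Im] by (simp_all add: o_def)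
    then have "(\<lambda>z. matrix_stress s mu \<sigma> (deriv f z)) absolutely_integrable_on K - C"
      by (subst matrix_stress_affine)
         (intro set_integral_add(1) const absolutely_integrable_scaleR_right)
    then have outer: "\<tau> absolutely_integrable_on K - C"
      by (rule absolutely_integrable_spike[OF _ negligible_empty]) (use \<tau>(2) K C_def in auto)
    have "(K \<inter> C) \<union> (K - C) = K" by blast
    with absolutely_integrable_Un[OF inner outer] show ?thesis by simp
  qed
  have 2: "set_lebesgue_integral lebesgue \<Omega> (\<lambda>z. \<tau> z *v grad \<phi> z) = 0" if "test_function \<Omega> \<phi>" for \<phi>
  proof -
    obtain K \<phi>' where K: "compact K" "K \<subseteq> \<Omega>" and \<phi>: "\<And>z. (\<phi> has_derivative \<phi>' z) (at z)"
        "\<And>v. continuous_on UNIV (\<lambda>z. \<phi>' z v)" "\<And>z. z \<notin> K \<Longrightarrow> \<phi> z = 0"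
      and \<phi>'_eq: "\<And>z. \<phi>' z 1 = dx \<phi> z" "\<And>z. \<phi>' z \<i> = dy \<phi> z"
      using test_functionD[OF \<open>test_function \<Omega> \<phi>\<close>] by metis
    note null = has_bochner_integral_set_lebesgueI
    have v0: "has_bochner_integral lebesgue (\<lambda>z. indicator \<Omega> z *\<^sub>R \<phi>' z v) 0" for v
      by (intro null has_integral_derivative_compact_support[OF \<Omega> K, of \<phi>])
        (use \<phi> continuous_on_subset[OF \<phi>(2)] in auto)
    \<comment> \<open>Applied to \<open>F = c (f - a z)\<close>. The rows of the stress come from
      \<open>c = 1\<close>, \<open>a = \<sigma>\<close> and from \<open>c = \<i>\<close>,
      \<open>a = 1\<close>.\<close>
    have F0: "has_bochner_integral lebesgue
        (\<lambda>z. indicator (\<Omega> - C) z *\<^sub>R Re (Complex (dx \<phi> z) (dy \<phi> z) * (c * (deriv f z - a)))) 0"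
      if h: "continuous_on \<Omega> h" "\<And>z. z \<in> C \<Longrightarrow> h z = 0"
        "\<And>z. z \<in> \<Omega> - C \<Longrightarrow> h z = Im (c * (f z - a * z))" for c a h
    proof -
      let ?F = "\<lambda>z. c * (f z - a * z)"
      have dF: "deriv ?F z = c * (deriv f z - a)" if "z \<in> \<Omega> - C" for z
        by (rule DERIV_imp_deriv) (use df[OF that] in \<open>auto intro!: derivative_eq_intros\<close>)
      have hol: "?F holomorphic_on \<Omega> - C"
        using f(1) by (intro holomorphic_intros) (simp add: C_def)
      have "(\<lambda>z. c * (deriv f z - a)) absolutely_integrable_on K - C"
      proof -
        have "K - C \<in> lmeasurable"
          by (intro fmeasurable_Diff lmeasurable_compact K) (use C in auto)
        then have "(\<lambda>z. deriv f z - a) absolutely_integrable_on K - C"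
          using int[OF K] by (intro set_integral_diff(1)) (auto simp: C_def)
        then show ?thesis
          using absolutely_integrable_linear[OF _ bounded_linear_mult_right[of c]] by (force simp: o_def)
      qed
      then have "deriv ?F absolutely_integrable_on K - C"
        by (rule absolutely_integrable_spike[OF _ negligible_empty]) (use dF K in auto)
      note null[OF has_integral_weak_Cauchy_Riemann[OF \<Omega> C hol h(1) h(2) h(3) K \<phi> this]]
      then have "has_bochner_integral lebesgue
        (\<lambda>z. indicator (\<Omega> - C) z *\<^sub>R Re (Complex (dx \<phi> z) (dy \<phi> z) * deriv ?F z)) 0"
        by (simp add: \<phi>'_eq)
      moreover have "(\<lambda>z. indicator (\<Omega> - C) z *\<^sub>R Re (Complex (dx \<phi> z) (dy \<phi> z) * deriv ?F z))
        = (\<lambda>z. indicator (\<Omega> - C) z *\<^sub>R Re (Complex (dx \<phi> z) (dy \<phi> z) * (c * (deriv f z - a))))"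
      proof
        fix z
        show "indicator (\<Omega> - C) z *\<^sub>R Re (Complex (dx \<phi> z) (dy \<phi> z) * deriv ?F z)
          = indicator (\<Omega> - C) z *\<^sub>R Re (Complex (dx \<phi> z) (dy \<phi> z) * (c * (deriv f z - a)))"
          by (cases "z \<in> \<Omega> - C") (simp_all add: dF del: times_complex.sel Diff_iff)
      qed
      ultimately show ?thesis by simp
    qed
    define I1 where "I1 z = Re (Complex (dx \<phi> z) (dy \<phi> z) * (\<i> * (deriv f z - 1)))" for z
    define I2 where "I2 z = Re (Complex (dx \<phi> z) (dy \<phi> z) * (deriv f z - of_real \<sigma>))" for z
    have I1: "has_bochner_integral lebesgue (\<lambda>z. indicator (\<Omega> - C) z *\<^sub>R I1 z) 0"
      unfolding I1_def
      by (rule F0[of "\<lambda>z. Re (f z) - Re z"]) (use f(2) fC in \<open>auto intro!: continuous_intros\<close>)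
    have I2: "has_bochner_integral lebesgue (\<lambda>z. indicator (\<Omega> - C) z *\<^sub>R I2 z) 0"
    proof -
      have "has_bochner_integral lebesgue (\<lambda>z. indicator (\<Omega> - C) z *\<^sub>R
          Re (Complex (dx \<phi> z) (dy \<phi> z) * (1 * (deriv f z - of_real \<sigma>)))) 0"
        by (rule F0[of "\<lambda>z. Im (f z) - \<sigma> * Im z"]) (use f(2) fC in \<open>auto intro!: continuous_intros\<close>)
      then show ?thesis unfolding I2_def by (simp only: mult_1)
    qed
    let ?e1 = "axis 1 1 :: real ^ 2" and ?e2 = "axis 2 1 :: real ^ 2"
    \<comment> \<open>\<open>T\<close> is the integrand \<open>\<tau> z *v grad \<phi> z\<close>
      with its null set of interface values corrected. Expanding along \<open>axis\<close> vectors
      reduces its integral to the scalar ones.\<close>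
    define T where "T z = s *\<^sub>R (dx \<phi> z *\<^sub>R ?e1 + dy \<phi> z *\<^sub>R ?e2)
        + (2 * mu) *\<^sub>R ((indicator (\<Omega> - C) z *\<^sub>R I2 z) *\<^sub>R ?e1 + (indicator (\<Omega> - C) z *\<^sub>R I1 z) *\<^sub>R ?e2)" for z
    have "has_bochner_integral lebesgue (\<lambda>z. s *\<^sub>R ((indicator \<Omega> z *\<^sub>R \<phi>' z 1) *\<^sub>R ?e1 + (indicator \<Omega> z *\<^sub>R \<phi>' z \<i>) *\<^sub>R ?e2)
        + (2 * mu) *\<^sub>R ((indicator (\<Omega> - C) z *\<^sub>R I2 z) *\<^sub>R ?e1 + (indicator (\<Omega> - C) z *\<^sub>R I1 z) *\<^sub>R ?e2))
      (s *\<^sub>R (0 *\<^sub>R ?e1 + 0 *\<^sub>R ?e2) + (2 * mu) *\<^sub>R (0 *\<^sub>R ?e1 + 0 *\<^sub>R ?e2))"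
      by (intro has_bochner_integral_add has_bochner_integral_scaleR_right has_bochner_integral_scaleR_left v0 I1 I2)
    moreover have "(\<lambda>z. s *\<^sub>R ((indicator \<Omega> z *\<^sub>R \<phi>' z 1) *\<^sub>R ?e1 + (indicator \<Omega> z *\<^sub>R \<phi>' z \<i>) *\<^sub>R ?e2)
        + (2 * mu) *\<^sub>R ((indicator (\<Omega> - C) z *\<^sub>R I2 z) *\<^sub>R ?e1 + (indicator (\<Omega> - C) z *\<^sub>R I1 z) *\<^sub>R ?e2))
      = (\<lambda>z. indicator \<Omega> z *\<^sub>R T z)"
      by (auto simp: fun_eq_iff T_def indicator_def \<phi>'_eq)
    ultimately have T: "T absolutely_integrable_on \<Omega>" "set_lebesgue_integral lebesgue \<Omega> T = 0"
      by (auto simp: has_bochner_integral_iff set_integrable_def set_lebesgue_integral_def)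
    have eq: "\<tau> z *v grad \<phi> z = T z" if "z \<in> \<Omega> - frontier E" for z
    proof (cases "z \<in> C")
      case True
      then have "\<tau> z = mat s" using that fr \<tau>(1) by auto
      then show ?thesis using True
        by (simp add: T_def grad_def mat_2_eq vec_eq_iff forall_2 matrix_vector_mult_def sum_2 axis_def)
    next
      case False
      then have "\<tau> z = matrix_stress s mu \<sigma> (deriv f z)" using that \<tau>(2) by (auto simp: C_def)
      then have "\<tau> z *v grad \<phi> z = s *\<^sub>R vector [dx \<phi> z, dy \<phi> z] + (2 * mu) *\<^sub>R vector [I2 z, I1 z]"
        unfolding grad_def I1_def I2_def by (simp only: matrix_stress_matrix_vector)
      then show ?thesis using that False by (simp add: T_def vector_2_axis)
    qed
    have "(\<lambda>z. \<tau> z *v grad \<phi> z) absolutely_integrable_on \<Omega>"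
      by (rule absolutely_integrable_spike[OF T(1) E(3) eq])
    then have "set_lebesgue_integral lebesgue \<Omega> (\<lambda>z. \<tau> z *v grad \<phi> z) = integral \<Omega> (\<lambda>z. \<tau> z *v grad \<phi> z)"
      by (rule set_lebesgue_integral_eq_integral)
    also have "\<dots> = integral \<Omega> T"
      by (rule integral_spike[OF E(3)]) (use eq in auto)
    also have "\<dots> = 0" using T set_lebesgue_integral_eq_integral[OF T(1)] by simp
    finally show ?thesis .
  qed
  show ?thesis using 1 2 by (simp add: weakly_divergence_free_def)
qed

section \<open>The elastic fields built from the potentials\<close>

lemma has_derivative_Re_Im_holomorphic:
  assumes "open D" "f holomorphic_on D" "z \<in> D"
  shows "((\<lambda>w. Re (f w)) has_derivative (\<lambda>v. Re (deriv f z * v))) (at z)"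
    and "((\<lambda>w. Im (f w)) has_derivative (\<lambda>v. Im (deriv f z * v))) (at z)"
proof -
  have "(f has_derivative (\<lambda>v. deriv f z * v)) (at z)"
    using holomorphic_derivI[OF assms(2,1,3)] by (simp add: has_field_derivative_def)
  from has_derivative_Re[OF this] has_derivative_Im[OF this]
  show "((\<lambda>w. Re (f w)) has_derivative (\<lambda>v. Re (deriv f z * v))) (at z)"
    "((\<lambda>w. Im (f w)) has_derivative (\<lambda>v. Im (deriv f z * v))) (at z)" .
qed

theorem mainTheorem11:
  fixes lam1 mu1 lam2 mu2 \<sigma>1 :: real
    and \<Omega> E :: "complex set"
    and V W V' :: "complex \<Rightarrow> real"
    and u :: "complex \<Rightarrow> real ^ 2"
    and \<epsilon> \<tau> :: "complex \<Rightarrow> real ^ 2 ^ 2"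
  assumes "lam2 + 2 * mu2 \<noteq> 0"
    and "\<sigma>1 = (2 * (lam1 + mu1) - lam2) / (lam2 + 2 * mu2)"
    and "inclusion_in_body \<Omega> E"
    and "conductivity_inclusion \<Omega> E \<sigma>1 V W"
    and "\<forall>z\<in>E. V' z = Im z"
    and "\<forall>z\<in>\<Omega> - E. V' z = - W z + (1 + \<sigma>1) * Im z"
    and "u = (\<lambda>z. vector [V z, V' z])"
    and "\<epsilon> = (\<lambda>z. vector [vector [dx V z, dx V' z], vector [dy V z, dy V' z]])"
    and "\<tau> = (\<lambda>z. (phase E lam1 lam2 z * trace (\<epsilon> z)) *\<^sub>R mat 1
                    + (2 * phase E mu1 mu2 z) *\<^sub>R \<epsilon> z)"
  shows "(\<forall>z \<in> \<Omega> - frontier E. transpose (\<epsilon> z) = \<epsilon> z \<and> \<epsilon> z = strain u z)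
    \<and> (\<forall>z\<in>E. \<epsilon> z = mat 1)
    \<and> elasticity_solution \<Omega> E lam1 mu1 lam2 mu2 u \<epsilon> \<tau>
    \<and> (\<forall>z\<in>E. \<tau> z = mat (2 * (lam1 + mu1)))
    \<and> hydrostatic_elastic_inclusion \<Omega> E lam1 mu1 lam2 mu2"
proof -
  note V'_E = assms(5) and V'_out = assms(6) and u_def = assms(7) and \<epsilon>_def = assms(8) and \<tau>_def = assms(9)
  have \<Omega>: "open \<Omega>" and E: "open E" "closure E \<subseteq> \<Omega>" "negligible (frontier E)"
    using assms(3) by (auto simp: inclusion_in_body_def)
  have contV: "continuous_on \<Omega> V" and contW: "continuous_on \<Omega> W"
    and gradV: "(\<lambda>z. (norm (grad V z))\<^sup>2) absolutely_integrable_on (\<Omega> - frontier E)"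
    and VW: "\<And>z. z \<in> E \<Longrightarrow> V z = Re z" "\<And>z. z \<in> E \<Longrightarrow> W z = \<sigma>1 * Im z"
    and "(\<lambda>z. Complex (V z) (W z)) analytic_on (\<Omega> - closure E)"
    using assms(4) by (auto simp: conductivity_inclusion_def)
  define f where "f z = Complex (V z) (W z)" for z
  define D where "D = \<Omega> - closure E"
  define s where "s = 2 * (lam1 + mu1)"
  \<comment> \<open>This is where the formula for \<open>\<sigma>1\<close> enters. In the matrix the
    strain has trace \<open>1 + \<sigma>1\<close>, and the constant part of the stress,
    \<open>lam2 * (1 + \<sigma>1) + 2 * mu2 * \<sigma>1\<close>, must match the hydrostatic stress
    \<open>s\<close> of the inclusion.\<close>
  have s: "s = lam2 + \<sigma>1 * (lam2 + 2 * mu2)"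
    using assms(1,2) by (simp add: s_def)
  have D: "open D" using \<Omega> by (simp add: D_def open_Diff)
  have E\<Omega>: "E \<subseteq> \<Omega>" using E(2) closure_subset by blast
  have phases: "\<Omega> - frontier E = E \<union> D"
    using E E\<Omega> closure_subset[of E] by (auto simp: frontier_def D_def interior_open)
  have hol: "f holomorphic_on D"
    using \<open>_ analytic_on _\<close> analytic_imp_holomorphic by (auto simp: f_def[abs_def] D_def)
  have hol': "deriv f holomorphic_on D" by (rule holomorphic_deriv[OF hol D])
  have contf: "continuous_on \<Omega> f"
    unfolding f_def[abs_def] by (intro continuous_intros contV contW)
  have V': "V' z = - W z + (1 + \<sigma>1) * Im z" if "z \<in> \<Omega>" for z
    using that V'_E V'_out VW by (cases "z \<in> E") (auto simp: algebra_simps)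

  have dE: "(V has_derivative Re) (at z)" "(V' has_derivative Im) (at z)" if "z \<in> E" for z
    by (rule has_derivative_transform_within_open[OF has_derivative_Re[OF has_derivative_ident] E(1) that];
        use VW in simp)
      (rule has_derivative_transform_within_open[OF has_derivative_Im[OF has_derivative_ident] E(1) that];
        use V'_E in simp)
  have dV: "(V has_derivative (\<lambda>v. Re (deriv f z * v))) (at z)" if "z \<in> D" for z
    using has_derivative_Re_Im_holomorphic(1)[OF D hol that] by (simp add: f_def)
  have dV': "(V' has_derivative (\<lambda>v. - Im (deriv f z * v) + (1 + \<sigma>1) * Im v)) (at z)" if "z \<in> D" for z
  proof (rule has_derivative_transform_within_open[OF _ D that])
    have "(W has_derivative (\<lambda>v. Im (deriv f z * v))) (at z)"
      using has_derivative_Re_Im_holomorphic(2)[OF D hol that] by (simp add: f_def)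
    then show "((\<lambda>z. - W z + (1 + \<sigma>1) * Im z) has_derivative
        (\<lambda>v. - Im (deriv f z * v) + (1 + \<sigma>1) * Im v)) (at z)"
      by (auto intro!: derivative_eq_intros simp del: times_complex.sel)
  qed (use V' D_def in auto)

  have \<epsilon>E: "\<epsilon> z = mat 1" if "z \<in> E" for z
    by (simp add: \<epsilon>_def dx_dy_eq[OF dE(1)[OF that]] dx_dy_eq[OF dE(2)[OF that]] mat_2_eq)
  \<comment> \<open>The off-diagonal entries agree since \<open>V_y = - W_x\<close>, and the trace
    is \<open>1 + \<sigma>1\<close> since \<open>V_x = W_y\<close>.\<close>
  have \<epsilon>D: "\<epsilon> z = vector [vector [Re (deriv f z), - Im (deriv f z)],
      vector [- Im (deriv f z), 1 + \<sigma>1 - Re (deriv f z)]]" if "z \<in> D" for z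
    by (simp add: \<epsilon>_def dx_dy_eq[OF dV[OF that]] dx_dy_eq[OF dV'[OF that]])
  have \<tau>E: "\<tau> z = mat s" if "z \<in> E" for z
    using that by (simp add: \<tau>_def \<epsilon>E phase_def s_def mat_2_eq trace_def sum_2 vec_eq_iff forall_2)
  have "D \<inter> E = {}" using closure_subset[of E] by (auto simp: D_def)
  then have \<tau>D: "\<tau> z = matrix_stress s mu2 \<sigma>1 (deriv f z)" if "z \<in> D" for z
    using that by (auto simp: \<tau>_def \<epsilon>D phase_def s matrix_stress_def mat_2_eq trace_def sum_2
        vec_eq_iff forall_2 algebra_simps)

  have du: "u differentiable (at z)" if "z \<in> E \<union> D" for z
  proof -
    have "V differentiable (at z)" "V' differentiable (at z)"
      using that dE dV dV' differentiable_def by blast+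
    then show ?thesis unfolding u_def vector_2_axis by (intro derivative_intros)
  qed
  have sym: "transpose (\<epsilon> z) = \<epsilon> z" if "z \<in> E \<union> D" for z
    using that by (auto simp: \<epsilon>E \<epsilon>D transpose_def vec_eq_iff forall_2 mat_2_eq)
  have strain: "\<epsilon> z = strain u z" if "z \<in> E \<union> D" for z
  proof -
    have "displacement_gradient u z = \<epsilon> z" by (simp add: displacement_gradient_def u_def \<epsilon>_def)
    then show ?thesis using sym[OF that] by (simp add: strain_def flip: scaleR_2)
  qed
  have contu: "continuous_on \<Omega> u"
  proof -
    have "continuous_on \<Omega> (\<lambda>z. vector [V z, - W z + (1 + \<sigma>1) * Im z] :: real ^ 2)"
      unfolding vector_2_axis by (intro continuous_intros contV contW)
    then show ?thesis by (rule continuous_on_eq) (simp add: u_def V')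
  qed

  \<comment> \<open>Since \<open>f' = V_x - \<i> V_y\<close>, the square of
    \<open>norm (deriv f z)\<close> is that of the gradient of \<open>V\<close>, which is
    integrable. On the set \<open>K - closure E\<close> of finite measure,
    \<open>m \<le> 1 + m^2\<close> then yields integrability of \<open>f'\<close> itself.\<close>
  have int: "deriv f absolutely_integrable_on K - closure E" if K: "compact K" "K \<subseteq> \<Omega>" for K
  proof (rule measurable_bounded_by_integrable_imp_absolutely_integrable)
    have KD: "K - closure E \<subseteq> D" using K by (auto simp: D_def)
    have meas: "K - closure E \<in> lmeasurable"
      by (intro fmeasurable_Diff lmeasurable_compact K) auto
    then show sets: "K - closure E \<in> sets lebesgue" by blast
    show "deriv f \<in> borel_measurable (lebesgue_on (K - closure E))"
      using holomorphic_on_imp_continuous_on[OF hol'] continuous_on_subset KD sets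
      by (blast intro: continuous_imp_measurable_on_sets_lebesgue)
    have "(\<lambda>z. (norm (grad V z))\<^sup>2) absolutely_integrable_on K - closure E"
      by (rule set_integrable_subset[OF gradV sets]) (use KD phases in auto)
    then have "(\<lambda>z. 1 + (norm (grad V z))\<^sup>2) absolutely_integrable_on K - closure E"
      by (intro set_integral_add(1) absolutely_integrable_on_const meas)
    then show "(\<lambda>z. 1 + (norm (grad V z))\<^sup>2) integrable_on K - closure E"
      using absolutely_integrable_on_def by blast
    fix z assume "z \<in> K - closure E"
    then have z: "z \<in> D" using KD by blast
    have "(norm (grad V z))\<^sup>2 = (norm (deriv f z))\<^sup>2"
      by (simp add: grad_def dx_dy_eq[OF dV[OF z]] norm_vec_def L2_set_def sum_2 cmod_power2)
    then show "norm (deriv f z) \<le> 1 + (norm (grad V z))\<^sup>2"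
      using le_1_plus_power2[of "norm (deriv f z)"] by simp
  qed

  have "weakly_divergence_free \<Omega> \<tau>"
  proof (rule weakly_divergence_free_two_phase[OF \<Omega> E])
    show "f holomorphic_on \<Omega> - closure E" using hol by (simp add: D_def)
    show "f z = Complex (Re z) (\<sigma>1 * Im z)" if "z \<in> E" for z using that by (simp add: f_def VW)
    show "\<tau> z = matrix_stress s mu2 \<sigma>1 (deriv f z)" if "z \<in> \<Omega> - closure E" for z
      using that \<tau>D by (simp add: D_def)
  qed (use contf int \<tau>E in auto)
  moreover have "\<tau> differentiable (at z) \<and> divergence \<tau> z = 0" if "z \<in> E \<union> D" for z
  proof (cases "z \<in> E")
    case True
    then have d: "(\<tau> has_derivative (\<lambda>_. 0)) (at z)"
      by (intro has_derivative_transform_within_open[OF has_derivative_const[where c = "mat s"] E(1)])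
        (auto simp: \<tau>E)
    have "((\<lambda>w. \<tau> w $ i $ j) has_derivative (\<lambda>v. (0 :: real ^ 2 ^ 2) $ i $ j)) (at z)" for i j
      by (intro bounded_linear.has_derivative[OF bounded_linear_vec_nth] d)
    note this[THEN dx_dy_eq(1)] this[THEN dx_dy_eq(2)]
    then show ?thesis using d by (auto simp: divergence_def vec_eq_iff intro: differentiableI)
  qed (use that divergence_matrix_stress[OF D hol' _ \<tau>D] in auto)
  ultimately have "divergence_free \<Omega> E \<tau>"
    by (simp add: divergence_free_def phases)
  then have sol: "elasticity_solution \<Omega> E lam1 mu1 lam2 mu2 u \<epsilon> \<tau>"
    unfolding elasticity_solution_def phases
    using contu du strain by (auto simp: \<tau>_def stress_def)
  then have "hydrostatic_elastic_inclusion \<Omega> E lam1 mu1 lam2 mu2"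
    unfolding hydrostatic_elastic_inclusion_def
    using \<epsilon>E \<tau>E by (intro exI[of _ u] exI[of _ \<epsilon>] exI[of _ \<tau>] exI[of _ 1] exI[of _ s]) auto
  then show ?thesis
    using sym strain \<epsilon>E \<tau>E sol by (simp add: phases s_def)
qed

end
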